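(* The constants $C_m$ ($m\ge2$ an integer) satisfy the asymptotic relation $$C_m-\gamma\;\sim\;\frac{\zeta(2)}{2^{m}}\qquad(m\to\infty).$$ Moreover, $$\sum_{m=2}^{\infty}(C_m-\gamma)=\gamma+\gamma_1(0)-\gamma_1(1),$$ $$\sum_{m=2}^{\infty}(-1)^m(C_m-\gamma)=\log\sqrt{2\pi}-\frac{\gamma}{2}.$$
   Context: $\zeta$ is the Riemann zeta function and $\gamma$ is Euler's constant. For an integer $m\ge2$, with $\operatorname{Li}_m(z)=\sum_{n=1}^{\infty}z^n/n^m$, $$C_m:=\lim_{n\to\infty}\left(\sum_{k=1}^n \operatorname{Li}_m\!\left(\frac1k\right)-\log n\right)=\gamma+\sum_{r=2}^{\infty}\frac{\zeta(r)}{r^m}.$$ For $a\in\{0,1\}$, $$\gamma_1(a):=\lim_{n\to\infty}\left(\sum_{k=1}^{n}\frac{\log k}{k+a}-\frac12\log^2 n\right),$$ where $\log^2 n=(\log n)^2$; $\gamma_1(0)$ is the classical first Stieltjes constant. *)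

theory Defs
  imports "HOL-Analysis.Analysis" "HOL-Library.Landau_Symbols"
begin

text \<open>
  The Riemann zeta function through its Dirichlet series. This is the Riemann zeta function
  for real \<open>s > 1\<close> only; no analytic continuation is modelled.
\<close>

definition zeta :: "real \<Rightarrow> real" where
  "zeta s = (\<Sum>n. 1 / real (Suc n) powr s)"

text \<open>The series converges for \<open>\<bar>z\<bar> \<le> 1\<close> when \<open>m \<ge> 2\<close>.\<close>

definition Li :: "nat \<Rightarrow> real \<Rightarrow> real" where
  "Li m z = (\<Sum>n. z ^ Suc n / real (Suc n) ^ m)"

text \<open>Meaningful for \<open>m \<ge> 2\<close>; already \<open>Li 1 1\<close> diverges.\<close>

definition C :: "nat \<Rightarrow> real" where
  "C m = lim (\<lambda>n. (\<Sum>k=1..n. Li m (1 / real k)) - ln (real n))"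

text \<open>The value \<open>gamma1 0\<close> is the classical first Stieltjes constant.\<close>

definition gamma1 :: "nat \<Rightarrow> real" where
  "gamma1 a = lim (\<lambda>n. (\<Sum>k=1..n. ln (real k) / real (k + a)) - (ln (real n))\<^sup>2 / 2)"

unbundle asymp_equiv_syntax

end

theory Submission
  imports Defs "HOL-Real_Asymp.Real_Asymp"
begin

text \<open>
  Expanding the polylogarithms and exchanging the order of summation gives
  \<open>C m - \<gamma> = (\<Sum>r\<ge>2. \<zeta>(r) / r^m)\<close>, whose leading term is \<open>\<zeta>(2) / 2^m\<close>. Summing the geometric series
  over \<open>m\<close> with signs \<open>c^m\<close>, \<open>c = \<plusminus>1\<close>, yields \<open>\<Sum>r\<ge>2. \<zeta>(r) / (r (r - c))\<close>; expanding \<open>\<zeta>\<close> and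
  exchanging the order once more, the inner sum over \<open>r\<close> is elementary (partial fractions and the
  series of \<open>ln (1 - x)\<close> at \<open>x = 1/k\<close>), and the partial sums over \<open>k\<close> collapse. The case \<open>c = 1\<close>
  leaves the defining limits of \<open>\<gamma>\<close> and \<open>\<gamma>\<^sub>1\<close>, the case \<open>c = -1\<close> leaves Stirling's formula.
\<close>

section \<open>Interchanging the order of a double series\<close>

text \<open>Fubini for series: summable absolute row sums make the family summable on the product,
  where rows and columns have the same total. The absolute rows have their own sums \<open>u\<close>
  because \<open>C_power_sums\<close> swaps a family with signs.\<close>

lemma sums_swap:
  fixes a :: "nat \<Rightarrow> nat \<Rightarrow> real"
  assumes row: "\<And>i. a i sums s i"
    and col: "\<And>j. (\<lambda>i. a i j) sums t j"
    and abs: "\<And>i. (\<lambda>j. \<bar>a i j\<bar>) sums u i"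
    and u: "summable u"
  shows "t sums (\<Sum>i. s i)"
proof -
  let ?f = "\<lambda>(i, j). a i j"
  have abs': "((\<lambda>j. norm (?f (i, j))) has_sum u i) UNIV" for i
    using sums_nonneg_imp_has_sum[OF abs[of i]] by simp
  have u0: "u i \<ge> 0" for i
    using sums_le[OF _ sums_zero abs[of i]] by simp
  have "u summable_on UNIV"
    using u u0 by (intro norm_summable_imp_summable_on) simp
  then have "(\<lambda>p. norm (?f p)) summable_on UNIV \<times> UNIV"
    using abs' by (intro summable_on_SigmaI[where g = u]) auto
  then have summ: "?f summable_on UNIV \<times> UNIV"
    by (rule abs_summable_summable)
  then obtain S where S: "(?f has_sum S) (UNIV \<times> UNIV)"
    by (auto simp: summable_on_def)
  have row': "(a i has_sum s i) UNIV" for i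
    using norm_summable_imp_has_sum[OF _ row[of i]] abs[of i] by (simp add: sums_iff)
  have "(s has_sum S) UNIV"
    using has_sum_SigmaD[OF S] row' by simp
  then have sS: "s sums S"
    by (rule has_sum_imp_sums)
  have S': "((\<lambda>(j, i). a i j) has_sum S) (UNIV \<times> UNIV)"
    using S by (subst (asm) has_sum_swap) (simp add: case_prod_unfold)
  \<comment> \<open>Columns are assumed to converge only in the ordered sense; summability on the
    product supplies an unordered sum, and uniqueness identifies it with \<open>t j\<close>.\<close>
  have col': "((\<lambda>i. a i j) has_sum t j) UNIV" for j
  proof -
    have "(\<lambda>(j, i). a i j) summable_on UNIV \<times> UNIV"
      using S' by (auto simp: summable_on_def)
    then have "(\<lambda>i. a i j) summable_on UNIV"
      by (rule summable_on_SigmaD1) simp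
    then obtain v where v: "((\<lambda>i. a i j) has_sum v) UNIV"
      by (auto simp: summable_on_def)
    from has_sum_imp_sums[OF v] col[of j] have "v = t j"
      by (rule sums_unique2)
    with v show ?thesis by simp
  qed
  have "(t has_sum S) UNIV"
    using has_sum_SigmaD[OF S'] col' by simp
  then have "t sums S"
    by (rule has_sum_imp_sums)
  with sS show ?thesis
    by (simp add: sums_iff)
qed

section \<open>Zeta values and series weighted by them\<close>

lemma summable_inverse_power_shift: "summable (\<lambda>n. 1 / real (n + 2) ^ 2)"
  using summable_ignore_initial_segment[OF inverse_power_summable[of 2, where 'a = real], of 2]
  by (simp add: field_simps)

lemma zeta_sums: "(\<lambda>k. 1 / real (Suc k) ^ (r + 2)) sums zeta (real (r + 2))"
proof -
  have "summable (\<lambda>k. inverse (real k ^ (r + 2)))"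
    by (rule inverse_power_summable) simp
  then have "summable (\<lambda>k. inverse (real (Suc k) ^ (r + 2)))"
    by (subst summable_Suc_iff)
  then have *: "summable (\<lambda>k. 1 / real (Suc k) ^ (r + 2))"
    by (simp only: inverse_eq_divide)
  have "zeta (real (r + 2)) = (\<Sum>k. 1 / real (Suc k) ^ (r + 2))"
    unfolding zeta_def by (simp only: powr_realpow of_nat_0_less_iff zero_less_Suc)
  with * show ?thesis
    by (simp add: sums_iff)
qed

lemma zeta_pos: "0 < zeta (real (r + 2))"
proof -
  have "0 < (\<Sum>k. 1 / real (Suc k) ^ (r + 2))"
    using zeta_sums[of r] by (intro suminf_pos) (auto simp: sums_iff)
  then show ?thesis
    using zeta_sums[of r] by (simp add: sums_iff)
qed

lemma zeta_le_zeta_2: "zeta (real (r + 2)) \<le> zeta 2"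
proof (rule sums_le[OF _ zeta_sums])
  show "1 / real (Suc k) ^ (r + 2) \<le> 1 / real (Suc k) ^ (0 + 2)" for k
    by (intro divide_left_mono power_increasing) (auto simp del: of_nat_Suc)
  show "(\<lambda>k. 1 / real (Suc k) ^ (0 + 2)) sums zeta 2"
    using zeta_sums[of 0] by simp
qed

lemma summable_zeta_weighted:
  assumes "summable w" and "\<And>r. 0 \<le> w r"
  shows "summable (\<lambda>r. w r * zeta (real (r + 2)))"
proof (rule summable_comparison_test')
  show "summable (\<lambda>r. w r * zeta 2)"
    using assms by (intro summable_mult2)
  show "norm (w r * zeta (real (r + 2))) \<le> w r * zeta 2" for r
    using zeta_le_zeta_2[of r] zeta_pos[of r] assms(2)[of r]
    by (simp add: abs_mult mult_left_mono)
qed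

text \<open>Nonnegative weights make the family its own absolute value, so the same row sums serve
  twice in \<open>sums_swap\<close>; they are summable because the zeta values are bounded by
  \<open>zeta 2\<close>.\<close>

lemma zeta_weighted_sums:
  assumes "summable w" and w: "\<And>r. 0 \<le> w r"
    and t: "\<And>k. (\<lambda>r. w r / real (Suc k) ^ (r + 2)) sums t k"
  shows "t sums (\<Sum>r. w r * zeta (real (r + 2)))"
proof (rule sums_swap[OF _ t _ summable_zeta_weighted[OF assms(1,2)]])
  show row: "(\<lambda>k. w r / real (Suc k) ^ (r + 2)) sums (w r * zeta (real (r + 2)))" for r
    using sums_mult[OF zeta_sums[of r], of "w r"] by (simp add: field_simps)
  show "(\<lambda>k. \<bar>w r / real (Suc k) ^ (r + 2)\<bar>) sums (w r * zeta (real (r + 2)))" for r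
    using row[of r] w[of r] by (simp add: abs_mult abs_divide power_abs)
qed

lemma summable_over_power:
  assumes "summable w" and w: "\<And>r. 0 \<le> w r"
  shows "summable (\<lambda>r. w r / real (Suc k) ^ r)"
proof (rule summable_comparison_test'[OF assms(1)])
  have "1 \<le> real (Suc k) ^ r" for r
    by (rule one_le_power) simp
  then show "norm (w r / real (Suc k) ^ r) \<le> w r" for r
    using w[of r] frac_le[of "w r" "w r" 1 "real (Suc k) ^ r"]
    by (simp add: abs_divide del: of_nat_Suc)
qed

lemma summable_inverse_power_weight:
  assumes "2 \<le> m"
  shows "summable (\<lambda>r. 1 / real (r + 2) ^ m)"
proof (rule summable_comparison_test'[OF summable_inverse_power_shift])
  show "norm (1 / real (r + 2) ^ m) \<le> 1 / real (r + 2) ^ 2" for r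
    using power_increasing[OF assms, of "real (r + 2)"]
    by (simp add: frac_le)
qed

section \<open>The series for \<open>C m\<close> and its leading term\<close>

text \<open>The first terms 1/k of the polylogarithms add up to \<open>harm n\<close>, which against
  \<open>ln n\<close> leaves Euler's constant; the remaining terms fall under
  \<open>zeta_weighted_sums\<close>.\<close>

lemma C_eq:
  assumes m: "2 \<le> m"
  shows "C m = euler_mascheroni + (\<Sum>r. zeta (real (r + 2)) / real (r + 2) ^ m)"
proof -
  define t where "t k = (\<Sum>r. 1 / real (r + 2) ^ m / real (Suc k) ^ (r + 2))" for k
  have summ: "summable (\<lambda>r. 1 / real (r + 2) ^ m / real (Suc k) ^ (r + 2))" for k
    using summable_divide[OF summable_over_power[OF summable_inverse_power_weight[OF m]], of k
        "real (Suc k) ^ 2"]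
    by (simp add: power_add power2_eq_square mult_ac)
  then have "t sums (\<Sum>r. 1 / real (r + 2) ^ m * zeta (real (r + 2)))"
    unfolding t_def
    by (intro zeta_weighted_sums summable_inverse_power_weight m) (auto simp: summable_sums)
  then have t: "(\<lambda>n. \<Sum>k<n. t k) \<longlonglongrightarrow> (\<Sum>r. zeta (real (r + 2)) / real (r + 2) ^ m)"
    by (simp add: sums_def)
  have Li: "Li m (1 / real (Suc k)) = 1 / real (Suc k) + t k" for k
  proof -
    have eq: "(\<lambda>r. (1 / real (Suc k)) ^ Suc (Suc r) / real (Suc (Suc r)) ^ m)
        = (\<lambda>r. 1 / real (r + 2) ^ m / real (Suc k) ^ (r + 2))"
      by (simp add: power_one_over field_simps)
    have "summable (\<lambda>r. (1 / real (Suc k)) ^ Suc (Suc r) / real (Suc (Suc r)) ^ m)"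
      unfolding eq by (rule summ)
    then have "summable (\<lambda>r. (1 / real (Suc k)) ^ Suc r / real (Suc r) ^ m)"
      by (subst (asm) summable_Suc_iff)
    from suminf_split_head[OF this] show ?thesis
      unfolding Li_def t_def eq by simp
  qed
  have "(\<Sum>k=1..n. Li m (1 / real k)) = harm n + (\<Sum>k<n. t k)" for n
  proof -
    have "(\<Sum>k=1..n. Li m (1 / real k)) = (\<Sum>k<n. Li m (1 / real (Suc k)))"
      by (rule sum.reindex_bij_witness[of _ Suc "\<lambda>k. k - 1"]) auto
    also have "\<dots> = (\<Sum>k<n. 1 / real (Suc k)) + (\<Sum>k<n. t k)"
      by (simp only: Li sum.distrib)
    also have "(\<Sum>k<n. 1 / real (Suc k)) = harm n"
      unfolding harm_def inverse_eq_divide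
      by (rule sum.reindex_bij_witness[of _ "\<lambda>k. k - 1" Suc]) auto
    finally show ?thesis .
  qed
  then have "(\<lambda>n. (\<Sum>k=1..n. Li m (1 / real k)) - ln (real n))
      = (\<lambda>n. (harm n - ln (real n)) + (\<Sum>k<n. t k))"
    by (simp add: algebra_simps)
  then show ?thesis
    unfolding C_def using tendsto_add[OF euler_mascheroni_LIMSEQ t] by (simp add: limI)
qed

text \<open>Beyond the exponent-2 term all bases are at least 3, so the remainder \<open>R\<close>
  is O(3^-m), negligible against 2^-m.\<close>

lemma C_asymp: "(\<lambda>m. C m - euler_mascheroni) \<sim>[at_top] (\<lambda>m. zeta 2 / 2 ^ m)"
proof -
  define R where "R m = (\<Sum>r. zeta (real (Suc r + 2)) / real (Suc r + 2) ^ m)" for m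
  define K where "K = zeta 2 * (\<Sum>r. 1 / real (Suc r + 2) ^ 2)"
  have S2: "summable (\<lambda>r. 1 / real (Suc r + 2) ^ 2)"
    using summable_inverse_power_shift by (subst summable_Suc_iff)
  have D: "C m - euler_mascheroni = zeta 2 / 2 ^ m + R m"
    and R: "0 \<le> R m" "R m \<le> 9 * K * (1 / 3 ^ m)" if m: "2 \<le> m" for m
  proof -
    have *: "summable (\<lambda>r. zeta (real (r + 2)) / real (r + 2) ^ m)"
      using summable_zeta_weighted[OF summable_inverse_power_weight[OF m]] by simp
    show "C m - euler_mascheroni = zeta 2 / 2 ^ m + R m"
      using suminf_split_head[OF *] by (simp add: C_eq[OF m] R_def)
    have **: "summable (\<lambda>r. zeta (real (Suc r + 2)) / real (Suc r + 2) ^ m)"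
      using * by (subst summable_Suc_iff)
    show "0 \<le> R m"
      unfolding R_def by (intro suminf_nonneg ** divide_nonneg_nonneg less_imp_le[OF zeta_pos]) auto
    \<comment> \<open>Two of the m factors are kept as a convergent inverse square, the other m - 2
      are bounded below by 3; this is where the factor 9 = 3^2 comes from.\<close>
    have bound: "zeta (real (Suc r + 2)) / real (Suc r + 2) ^ m
        \<le> (zeta 2 * (1 / 3) ^ (m - 2)) * (1 / real (Suc r + 2) ^ 2)" for r
    proof -
      have "real (Suc r + 2) ^ m = real (Suc r + 2) ^ (m - 2) * real (Suc r + 2) ^ 2"
        using m by (simp only: power_add[symmetric] le_add_diff_inverse2)
      moreover have "3 ^ (m - 2) \<le> real (Suc r + 2) ^ (m - 2)"
        by (rule power_mono) auto
      ultimately have "3 ^ (m - 2) * real (Suc r + 2) ^ 2 \<le> real (Suc r + 2) ^ m"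
        by (simp add: mult_right_mono del: of_nat_Suc of_nat_add)
      then have "zeta (real (Suc r + 2)) / real (Suc r + 2) ^ m
          \<le> zeta 2 / (3 ^ (m - 2) * real (Suc r + 2) ^ 2)"
        using zeta_pos[of 0] by (intro frac_le zeta_le_zeta_2) auto
      then show ?thesis
        by (simp add: power_one_over)
    qed
    have "R m \<le> (\<Sum>r. (zeta 2 * (1 / 3) ^ (m - 2)) * (1 / real (Suc r + 2) ^ 2))"
      unfolding R_def by (intro suminf_le bound ** summable_mult S2)
    also have "\<dots> = (1 / 3) ^ (m - 2) * K"
      by (subst suminf_mult[OF S2]) (simp add: K_def)
    also have "(1 / 3 :: real) ^ (m - 2) = 9 * (1 / 3) ^ m"
      using m by (simp add: power_diff power2_eq_square)
    finally show "R m \<le> 9 * K * (1 / 3 ^ m)"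
      by (simp add: power_one_over mult_ac)
  qed
  have z: "0 < zeta 2"
    using zeta_pos[of 0] by simp
  have "R \<in> O(\<lambda>m. 1 / 3 ^ m)"
    by (rule bigoI[of _ "9 * K"], rule eventually_mono[OF eventually_ge_at_top[of 2]])
      (use R in \<open>simp add: power_abs\<close>)
  also have "(\<lambda>m. 1 / 3 ^ m) \<in> o(\<lambda>m. 1 / 2 ^ m :: real)"
    by real_asymp
  also have "(\<lambda>m. 1 / 2 ^ m) \<in> O(\<lambda>m. zeta 2 / 2 ^ m)"
    using z by (intro bigoI[of _ "1 / zeta 2"]) (simp add: field_simps)
  finally have "R \<in> o(\<lambda>m. zeta 2 / 2 ^ m)" .
  moreover have "eventually (\<lambda>m. (C m - euler_mascheroni) - zeta 2 / 2 ^ m = R m) at_top"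
    using eventually_ge_at_top[of 2] by eventually_elim (simp add: D)
  ultimately have "(\<lambda>m. (C m - euler_mascheroni) - zeta 2 / 2 ^ m) \<in> o(\<lambda>m. zeta 2 / 2 ^ m)"
    by (subst landau_o.small.in_cong)
  then show ?thesis
    by (rule smallo_imp_asymp_equiv)
qed

section \<open>Summation over m with signs c^m\<close>

text \<open>Both factors of the denominator are at least r + 1, which gives summability up to and
  including the endpoint c = 1.\<close>

lemma weight_bounds:
  fixes c :: real
  assumes "\<bar>c\<bar> \<le> 1"
  shows "0 \<le> 1 / (real (r + 2) * (real (r + 2) - c))"
    and "1 / (real (r + 2) * (real (r + 2) - c)) \<le> 1 / (real r + 1) ^ 2"
proof -
  have "real r + 1 \<le> real (r + 2) - c"
    using assms by simp
  moreover have "(real r + 1) * (real r + 1) \<le> real (r + 2) * (real (r + 2) - c)"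
    using calculation by (intro mult_mono) auto
  ultimately show "0 \<le> 1 / (real (r + 2) * (real (r + 2) - c))"
    and "1 / (real (r + 2) * (real (r + 2) - c)) \<le> 1 / (real r + 1) ^ 2"
    by (auto simp: power2_eq_square intro!: frac_le)
qed

lemma summable_weight:
  fixes c :: real
  assumes "\<bar>c\<bar> \<le> 1"
  shows "summable (\<lambda>r. 1 / (real (r + 2) * (real (r + 2) - c)))"
proof (rule summable_comparison_test')
  show "summable (\<lambda>r. 1 / (real r + 1) ^ 2)"
    using zeta_sums[of 0] by (simp add: sums_iff add.commute power2_eq_square)
  show "norm (1 / (real (r + 2) * (real (r + 2) - c))) \<le> 1 / (real r + 1) ^ 2" for r
    using weight_bounds[OF assms, of r] by (simp only: real_norm_def abs_of_nonneg)
qed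

text \<open>For fixed r the sum over m is geometric with ratio c/(r+2); for fixed m the sum over r
  is c^m times the series of \<open>C_eq\<close>. Absolute values only replace c by |c|, so
  \<open>geo\<close> is proved for a general \<open>d\<close> and used for both.\<close>

lemma C_power_sums:
  fixes c :: real
  assumes c: "\<bar>c\<bar> \<le> 1"
  shows "(\<lambda>m. c ^ m * (C (m + 2) - euler_mascheroni)) sums
    (\<Sum>r. 1 / (real (r + 2) * (real (r + 2) - c)) * zeta (real (r + 2)))"
proof (rule sums_swap[OF _ _ _ summable_zeta_weighted])
  let ?a = "\<lambda>c r m. c ^ m * zeta (real (r + 2)) / real (r + 2) ^ (m + 2)"
  have geo: "?a d r sums (1 / (real (r + 2) * (real (r + 2) - d)) * zeta (real (r + 2)))"
    if d: "\<bar>d\<bar> \<le> 1" for d r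
  proof -
    have "norm (d / real (r + 2)) < 1"
      using d by (simp add: abs_divide)
    from sums_mult[OF geometric_sums[OF this], of "zeta (real (r + 2)) / real (r + 2) ^ 2"]
    have "(\<lambda>m. zeta (real (r + 2)) / real (r + 2) ^ 2 * (d / real (r + 2)) ^ m) sums
        (zeta (real (r + 2)) / real (r + 2) ^ 2 * (1 / (1 - d / real (r + 2))))" .
    also have "(\<lambda>m. zeta (real (r + 2)) / real (r + 2) ^ 2 * (d / real (r + 2)) ^ m) = ?a d r"
      by (simp add: power_divide power_add power2_eq_square mult_ac)
    also have "zeta (real (r + 2)) / real (r + 2) ^ 2 * (1 / (1 - d / real (r + 2)))
        = 1 / (real (r + 2) * (real (r + 2) - d)) * zeta (real (r + 2))"
    proof -
      have "real (r + 2) - d \<noteq> 0" "real (r + 2) \<noteq> 0"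
        using d by auto
      then show ?thesis
        by (simp add: divide_simps power2_eq_square del: of_nat_add)
    qed
    finally show ?thesis .
  qed
  show "?a c r sums (1 / (real (r + 2) * (real (r + 2) - c)) * zeta (real (r + 2)))" for r
    by (rule geo[OF c])
  have "\<bar>?a c r m\<bar> = ?a \<bar>c\<bar> r m" for r m
    using zeta_pos[of r] by (simp add: abs_mult abs_divide power_abs)
  then show "(\<lambda>m. \<bar>?a c r m\<bar>) sums
      (1 / (real (r + 2) * (real (r + 2) - \<bar>c\<bar>)) * zeta (real (r + 2)))" for r
    using geo[of "\<bar>c\<bar>" r] c by simp
  show "(\<lambda>r. ?a c r m) sums (c ^ m * (C (m + 2) - euler_mascheroni))" for m
  proof -
    have "summable (\<lambda>r. zeta (real (r + 2)) / real (r + 2) ^ (m + 2))"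
      using summable_zeta_weighted[OF summable_inverse_power_weight[of "m + 2"]] by simp
    from sums_mult[OF summable_sums[OF this], of "c ^ m"] show ?thesis
      by (simp add: C_eq)
  qed
  show "summable (\<lambda>r. 1 / (real (r + 2) * (real (r + 2) - \<bar>c\<bar>)))"
    using c by (intro summable_weight) simp
  show "0 \<le> 1 / (real (r + 2) * (real (r + 2) - \<bar>c\<bar>))" for r
    using c by (intro weight_bounds) simp
qed

text \<open>Here \<open>t k\<close> is the inner sum over r after the second exchange. The partial
  sums run to \<open>Suc n\<close> to match \<open>sum_inner_pos\<close> and
  \<open>sum_inner_neg\<close>.\<close>

lemma C_power_sums_eq:
  fixes c :: real
  assumes c: "\<bar>c\<bar> \<le> 1"
    and t: "\<And>k. (\<lambda>r. 1 / (real (r + 2) * (real (r + 2) - c)) / real (Suc k) ^ (r + 2)) sums t k"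
    and lim: "(\<lambda>n. \<Sum>k<Suc n. t k) \<longlonglongrightarrow> L"
  shows "(\<lambda>m. c ^ m * (C (m + 2) - euler_mascheroni)) sums L"
proof -
  have "t sums (\<Sum>r. 1 / (real (r + 2) * (real (r + 2) - c)) * zeta (real (r + 2)))"
    using summable_weight[OF c] weight_bounds(1)[OF c] t by (rule zeta_weighted_sums)
  then have "(\<lambda>n. \<Sum>k<Suc n. t k) \<longlonglongrightarrow>
      (\<Sum>r. 1 / (real (r + 2) * (real (r + 2) - c)) * zeta (real (r + 2)))"
    unfolding sums_def by (rule LIMSEQ_Suc)
  from LIMSEQ_unique[OF this lim] C_power_sums[OF c] show ?thesis
    by simp
qed

section \<open>Closed forms of the inner sums over r\<close>

lemma ln_one_minus_sums:
  fixes x :: real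
  assumes "\<bar>x\<bar> < 1"
  shows "(\<lambda>r. x ^ Suc r / real (Suc r)) sums (- ln (1 - x))"
proof -
  have "(\<lambda>n. x ^ n / real n) sums (- ln (1 - x))"
    using sums_minus[OF ln_series'[of "- x"]] assms by simp
  \<comment> \<open>The term at index 0 is 1/0 = 0, so the shift loses nothing.\<close>
  then show ?thesis
    by (subst sums_Suc_iff) simp
qed

text \<open>The formulas below also cover \<open>k = 0\<close>, where \<open>ln 0\<close> has coefficient zero.\<close>

lemma inner_sums_pos:
  "(\<lambda>r. 1 / (real (r + 2) * (real (r + 2) - 1)) / real (Suc k) ^ (r + 2)) sums
    (1 / real (Suc k) + real k / real (Suc k) * (ln (real k) - ln (real (Suc k))))"
proof (cases "k = 0")
  case True
  \<comment> \<open>For k = 0 the logarithm series would be taken at x = 1, where it diverges; the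
    partial fractions telescope instead.\<close>
  have "(\<lambda>r. 1 / real (Suc r) - 1 / real (Suc (Suc r))) sums (1 / real (Suc 0) - 0)"
    by (intro telescope_sums') real_asymp
  then show ?thesis
    using True by (simp add: field_simps)
next
  case False
  define x where "x = 1 / real (Suc k)"
  have x: "0 < x" "\<bar>x\<bar> < 1"
    using False by (auto simp: x_def)
  have L: "ln (1 - x) = ln (real k) - ln (real (Suc k))"
  proof -
    have "1 - x = real k / real (Suc k)"
      by (simp add: x_def field_simps)
    then show ?thesis
      using False by (simp add: ln_div del: of_nat_Suc)
  qed
  note s1 = ln_one_minus_sums[OF x(2)]
  have s2: "(\<lambda>r. x ^ Suc (Suc r) / real (Suc (Suc r))) sums (- ln (1 - x) - x)"
    using s1 by (subst sums_Suc_iff) simp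
  \<comment> \<open>Partial fractions 1/(r+1) - 1/(r+2); the factor x brings the first series to the
    common power x^(r+2).\<close>
  have "(\<lambda>r. x * (x ^ Suc r / real (Suc r)) - x ^ Suc (Suc r) / real (Suc (Suc r))) sums
      (x * - ln (1 - x) - (- ln (1 - x) - x))"
    by (intro sums_diff sums_mult s1 s2)
  also have "(\<lambda>r. x * (x ^ Suc r / real (Suc r)) - x ^ Suc (Suc r) / real (Suc (Suc r)))
      = (\<lambda>r. 1 / (real (r + 2) * (real (r + 2) - 1)) / real (Suc k) ^ (r + 2))"
  proof
    fix r
    have "x * (x ^ Suc r / real (Suc r)) - x ^ Suc (Suc r) / real (Suc (Suc r))
        = (1 / real (Suc r) - 1 / real (Suc (Suc r))) * x ^ (r + 2)"
      by (simp add: algebra_simps)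
    also have "1 / real (Suc r) - 1 / real (Suc (Suc r))
        = 1 / (real (r + 2) * (real (r + 2) - 1))"
      by (simp add: field_simps)
    finally show "x * (x ^ Suc r / real (Suc r)) - x ^ Suc (Suc r) / real (Suc (Suc r))
        = 1 / (real (r + 2) * (real (r + 2) - 1)) / real (Suc k) ^ (r + 2)"
      by (simp add: x_def power_one_over)
  qed
  also have "x * - ln (1 - x) - (- ln (1 - x) - x)
      = 1 / real (Suc k) + real k / real (Suc k) * (ln (real k) - ln (real (Suc k)))"
  proof -
    have "real k / real (Suc k) = 1 - x"
      by (simp add: x_def field_simps)
    then show ?thesis
      unfolding L x_def[symmetric] by (simp only:) (simp add: algebra_simps)
  qed
  finally show ?thesis .
qed

lemma inner_sums_neg:
  "(\<lambda>r. 1 / (real (r + 2) * (real (r + 2) - (- 1))) / real (Suc k) ^ (r + 2)) sums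
    (1 - 1 / (2 * real (Suc k)) + real k * (ln (real k) - ln (real (Suc k))))"
proof (cases "k = 0")
  case True
  have "(\<lambda>r. 1 / real (r + 2) - 1 / real (Suc r + 2)) sums (1 / real (0 + 2) - 0)"
    by (intro telescope_sums') real_asymp
  then show ?thesis
    using True by (simp add: field_simps)
next
  case False
  define x where "x = 1 / real (Suc k)"
  have x: "0 < x" "\<bar>x\<bar> < 1"
    using False by (auto simp: x_def)
  have L: "ln (1 - x) = ln (real k) - ln (real (Suc k))"
  proof -
    have "1 - x = real k / real (Suc k)"
      by (simp add: x_def field_simps)
    then show ?thesis
      using False by (simp add: ln_div del: of_nat_Suc)
  qed
  note s1 = ln_one_minus_sums[OF x(2)]
  have s2: "(\<lambda>r. x ^ Suc (Suc r) / real (Suc (Suc r))) sums (- ln (1 - x) - x)"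
    using s1 by (subst sums_Suc_iff) simp
  have s3: "(\<lambda>r. x ^ Suc (Suc (Suc r)) / real (Suc (Suc (Suc r)))) sums
      (- ln (1 - x) - x - x\<^sup>2 / 2)"
    using s2 by (subst sums_Suc_iff) (simp add: power2_eq_square)
  \<comment> \<open>Now the fractions are 1/(r+2) - 1/(r+3); the second logarithm tail carries
    x^(r+3), hence the factor 1/x.\<close>
  have "(\<lambda>r. x ^ Suc (Suc r) / real (Suc (Suc r))
        - 1 / x * (x ^ Suc (Suc (Suc r)) / real (Suc (Suc (Suc r))))) sums
      ((- ln (1 - x) - x) - 1 / x * (- ln (1 - x) - x - x\<^sup>2 / 2))"
    by (intro sums_diff sums_mult s2 s3)
  also have "(\<lambda>r. x ^ Suc (Suc r) / real (Suc (Suc r))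
        - 1 / x * (x ^ Suc (Suc (Suc r)) / real (Suc (Suc (Suc r)))))
      = (\<lambda>r. 1 / (real (r + 2) * (real (r + 2) - (- 1))) / real (Suc k) ^ (r + 2))"
  proof
    fix r
    have "x ^ Suc (Suc r) / real (Suc (Suc r))
        - 1 / x * (x ^ Suc (Suc (Suc r)) / real (Suc (Suc (Suc r))))
        = (1 / real (Suc (Suc r)) - 1 / real (Suc (Suc (Suc r)))) * x ^ (r + 2)"
      using x by (simp add: algebra_simps)
    also have "1 / real (Suc (Suc r)) - 1 / real (Suc (Suc (Suc r)))
        = 1 / (real (r + 2) * (real (r + 2) - (- 1)))"
      by (simp add: field_simps)
    finally show "x ^ Suc (Suc r) / real (Suc (Suc r))
        - 1 / x * (x ^ Suc (Suc (Suc r)) / real (Suc (Suc (Suc r))))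
        = 1 / (real (r + 2) * (real (r + 2) - (- 1))) / real (Suc k) ^ (r + 2)"
      by (simp add: x_def power_one_over)
  qed
  also have "(- ln (1 - x) - x) - 1 / x * (- ln (1 - x) - x - x\<^sup>2 / 2)
      = 1 - x / 2 + (1 / x - 1) * ln (1 - x)"
    using x by (simp add: field_simps power2_eq_square)
  also have "\<dots> = 1 - 1 / (2 * real (Suc k)) + real k * (ln (real k) - ln (real (Suc k)))"
    unfolding L by (simp add: x_def)
  finally show ?thesis .
qed

section \<open>Stieltjes limits and collapse of the partial sums over k\<close>

text \<open>\<open>gamma1\<close> is a bare \<open>lim\<close>, so convergence has to be shown. The
  increments are of order log n / n^2; the exponent -3/2 absorbs the logarithm and still gives a
  convergent majorant.\<close>

lemma gamma1_LIMSEQ: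
  "(\<lambda>n. (\<Sum>k=1..n. ln (real k) / real (k + a)) - (ln (real n))\<^sup>2 / 2) \<longlonglongrightarrow> gamma1 a"
proof -
  define f where
    "f n = (\<Sum>k=1..n. ln (real k) / real (k + a)) - (ln (real n))\<^sup>2 / 2" for n
  \<comment> \<open>\<open>real_asymp\<close> handles the difference of squares only in factored form.\<close>
  have diff: "f (Suc n) - f n = ln (real (Suc n)) / real (Suc n + a)
      - (ln (real (Suc n)) - ln (real n)) * (ln (real (Suc n)) + ln (real n)) / 2" for n
    by (simp add: f_def field_simps power2_eq_square)
  have "(\<lambda>n. ln (real (Suc n)) / real (Suc n + a)
      - (ln (real (Suc n)) - ln (real n)) * (ln (real (Suc n)) + ln (real n)) / 2)
      \<in> O(\<lambda>n. real n powr (- 3 / 2))"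
    by real_asymp
  then have "summable (\<lambda>n. f (Suc n) - f n)"
    unfolding diff by (rule summable_comparison_test_bigo[rotated]) (simp add: summable_real_powr_iff)
  then have "convergent f"
    by (simp add: summable_iff_convergent sum_lessThan_telescope convergent_diff_const_right_iff)
  then show ?thesis
    unfolding gamma1_def f_def[abs_def] by (simp add: convergent_LIMSEQ_iff)
qed

text \<open>With k/(k+1) = 1 - 1/(k+1), the differences of logarithms telescope, and the products
  with 1/(k+1) separate into the sums for \<open>gamma1 0\<close> and
  \<open>gamma1 1\<close>.\<close>

lemma sum_inner_pos:
  "(\<Sum>k<Suc n. 1 / real (Suc k) + real k / real (Suc k) * (ln (real k) - ln (real (Suc k))))
    = harm (Suc n) - ln (real (Suc n)) + (\<Sum>k=1..Suc n. ln (real k) / real (k + 0))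
      - (\<Sum>k=1..n. ln (real k) / real (k + 1))"
proof (induction n)
  case 0
  then show ?case by (simp add: harm_def)
next
  case (Suc n)
  have eq: "real (Suc n) / real (Suc (Suc n)) = 1 - 1 / real (Suc (Suc n))"
    by (simp add: field_simps)
  show ?case
    unfolding sum.lessThan_Suc[of _ "Suc n"] Suc.IH harm_Suc[of "Suc n"] eq
    by (simp add: algebra_simps inverse_eq_divide diff_divide_distrib del: of_nat_Suc)
qed

lemma ln_fact_Suc: "ln (fact (Suc n) :: real) = ln (real (Suc n)) + ln (fact n)"
  by (simp add: ln_mult_pos del: of_nat_Suc)

text \<open>Each k ln k - k ln(k+1) equals k ln k - (k+1) ln(k+1) + ln(k+1): a telescoping part and
  the logarithm of a factorial.\<close>

lemma sum_inner_neg: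
  "(\<Sum>k<Suc n. 1 - 1 / (2 * real (Suc k)) + real k * (ln (real k) - ln (real (Suc k))))
    = real (Suc n) - harm (Suc n) / 2 - real (Suc n) * ln (real (Suc n)) + ln (fact (Suc n))"
proof (induction n)
  case 0
  then show ?case by (simp add: harm_def)
next
  case (Suc n)
  show ?case
    unfolding sum.lessThan_Suc[of _ "Suc n"] Suc.IH harm_Suc[of "Suc n"]
    by (simp add: ln_fact_Suc[of "Suc n"] field_simps del: fact_Suc)
qed

section \<open>Stirling's formula from Wallis's product\<close>

lemma wallis_prod_eq:
  "(\<Prod>k=1..n. (4 * real k ^ 2) / (4 * real k ^ 2 - 1))
    = (2 ^ (2 * n) * fact n ^ 2) ^ 2 / (fact (2 * n) ^ 2 * real (2 * n + 1))"
proof (induction n)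
  case 0
  then show ?case by simp
next
  case (Suc n)
  have "(4 * real (Suc n) ^ 2) / (4 * real (Suc n) ^ 2 - 1)
      = 4 * real (Suc n) ^ 2 / ((2 * real n + 1) * (2 * real n + 3))"
    by (simp add: power2_eq_square algebra_simps)
  moreover have "fact (2 * Suc n) = 2 * real (Suc n) * (2 * real n + 1) * fact (2 * n)"
    by (simp add: algebra_simps)
  \<comment> \<open>With \<open>F\<close> for n!, \<open>G\<close> for (2n)! and \<open>y\<close>
    for 2^(2n) as free variables, the induction step is a plain rational identity.\<close>
  moreover have "(y * F ^ 2) ^ 2 / (G ^ 2 * d) * (4 * N ^ 2 / (d * e))
      = (4 * y * (N * F) ^ 2) ^ 2 / ((2 * N * d * G) ^ 2 * e)"
    if "G \<noteq> 0" "N \<noteq> 0" "d \<noteq> 0" "e \<noteq> 0" for y F G N d e :: real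
    using that by (simp add: field_simps power2_eq_square)
  from this[of "fact (2 * n)" "real (Suc n)" "2 * real n + 1" "2 * real n + 3" "2 ^ (2 * n)" "fact n"]
  have "(2 ^ (2 * n) * fact n ^ 2) ^ 2 / (fact (2 * n) ^ 2 * (2 * real n + 1))
      * (4 * real (Suc n) ^ 2 / ((2 * real n + 1) * (2 * real n + 3)))
      = (4 * 2 ^ (2 * n) * (real (Suc n) * fact n) ^ 2) ^ 2
        / ((2 * real (Suc n) * (2 * real n + 1) * fact (2 * n)) ^ 2 * (2 * real n + 3))"
    by simp
  moreover have "real (2 * n + 1) = 2 * real n + 1" "real (2 * Suc n + 1) = 2 * real n + 3"
    "(2 :: real) ^ (2 * Suc n) = 4 * 2 ^ (2 * n)" "fact (Suc n) = real (Suc n) * fact n"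
    by simp_all
  ultimately show ?case
    using Suc.IH by (simp only: prod.cl_ivl_Suc if_False not_less_eq_eq) simp
qed

text \<open>Summable increments give some limit L; Wallis's product fixes it through 2L - 2 ln 2 =
  ln(pi/2).\<close>

lemma stirling_ln_fact:
  "(\<lambda>n. ln (fact n) - real n * ln (real n) + real n - ln (real n) / 2) \<longlonglongrightarrow> ln (2 * pi) / 2"
proof -
  define f where "f n = ln (fact n) - real n * ln (real n) + real n - ln (real n) / 2" for n
  have diff: "f (Suc n) - f n = ln (real (Suc n)) - real (Suc n) * ln (real (Suc n))
      + real n * ln (real n) + 1 - (ln (real (Suc n)) - ln (real n)) / 2" for n
    by (simp add: f_def ln_fact_Suc field_simps del: fact_Suc)
  have "(\<lambda>n. ln (real (Suc n)) - real (Suc n) * ln (real (Suc n))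
      + real n * ln (real n) + 1 - (ln (real (Suc n)) - ln (real n)) / 2)
      \<in> O(\<lambda>n. real n powr (- 3 / 2))"
    by real_asymp
  then have "summable (\<lambda>n. f (Suc n) - f n)"
    unfolding diff by (rule summable_comparison_test_bigo[rotated]) (simp add: summable_real_powr_iff)
  then have "convergent f"
    by (simp add: summable_iff_convergent sum_lessThan_telescope convergent_diff_const_right_iff)
  then obtain L where L: "f \<longlonglongrightarrow> L"
    by (auto simp: convergent_def)
  have L2: "(\<lambda>n. f (2 * n)) \<longlonglongrightarrow> L"
    using LIMSEQ_subseq_LIMSEQ[OF L, of "\<lambda>n. 2 * n"] by (simp add: strict_mono_def o_def)
  have "(\<lambda>n. ln (\<Prod>k=1..n. (4 * real k ^ 2) / (4 * real k ^ 2 - 1))) \<longlonglongrightarrow> ln (pi / 2)"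
    by (intro tendsto_ln wallis) simp
  \<comment> \<open>The weights 4 and -2 match the factorials in \<open>wallis_prod_eq\<close>; the
    terms in n ln n and n then cancel, and the leftover 4 n ln 2 is the power of 2.\<close>
  moreover have "eventually (\<lambda>n. ln (\<Prod>k=1..n. (4 * real k ^ 2) / (4 * real k ^ 2 - 1))
      = 4 * f n - 2 * f (2 * n) + (ln (real n) - ln 2 - ln (real (2 * n + 1)))) at_top"
    using eventually_gt_at_top[of 0]
  proof eventually_elim
    case (elim n)
    have "ln (\<Prod>k=1..n. (4 * real k ^ 2) / (4 * real k ^ 2 - 1))
        = 4 * real n * ln 2 + 4 * ln (fact n) - 2 * ln (fact (2 * n)) - ln (real (2 * n + 1))"
      unfolding wallis_prod_eq
      by (simp add: ln_div ln_mult_pos ln_realpow power_mult_distrib power_mult[symmetric]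
          del: of_nat_add)
    moreover have "ln (real (2 * n)) = ln 2 + ln (real n)"
      using elim by (simp add: ln_mult_pos)
    ultimately show ?case
      by (simp add: f_def algebra_simps diff_divide_distrib)
  qed
  ultimately have "(\<lambda>n. 4 * f n - 2 * f (2 * n) + (ln (real n) - ln 2 - ln (real (2 * n + 1))))
      \<longlonglongrightarrow> ln (pi / 2)"
    by (rule Lim_transform_eventually)
  moreover have "(\<lambda>n. ln (real n) - ln 2 - ln (real (2 * n + 1))) \<longlonglongrightarrow> - 2 * ln 2"
    by real_asymp
  then have "(\<lambda>n. 4 * f n - 2 * f (2 * n) + (ln (real n) - ln 2 - ln (real (2 * n + 1))))
      \<longlonglongrightarrow> 4 * L - 2 * L + - 2 * ln 2"
    by (intro tendsto_intros L L2)
  ultimately have "ln (pi / 2) = 4 * L - 2 * L + - 2 * ln 2"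
    by (rule LIMSEQ_unique)
  then have "L = ln (2 * pi) / 2"
    by (simp add: ln_div ln_mult_pos)
  with L show ?thesis
    by (simp add: f_def[abs_def])
qed

section \<open>Evaluation of the plain and the alternating sum\<close>

lemma C_sums: "(\<lambda>m. C (m + 2) - euler_mascheroni) sums (euler_mascheroni + gamma1 0 - gamma1 1)"
proof -
  define A where "A a n = (\<Sum>k=1..n. ln (real k) / real (k + a)) - (ln (real n))\<^sup>2 / 2" for a n
  have A: "A a \<longlonglongrightarrow> gamma1 a" for a
    unfolding A_def by (rule gamma1_LIMSEQ)
  \<comment> \<open>In \<open>sum_inner_pos\<close> one sum ends at n + 1 and the other at n, so the
    squared logarithms cancel only in the limit.\<close>
  have "(\<lambda>n. (ln (real (Suc n)))\<^sup>2 / 2 - (ln (real n))\<^sup>2 / 2) \<longlonglongrightarrow> 0"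
    by real_asymp
  then have "(\<lambda>n. (harm (Suc n) - ln (real (Suc n))) + A 0 (Suc n) - A 1 n
      + ((ln (real (Suc n)))\<^sup>2 / 2 - (ln (real n))\<^sup>2 / 2))
      \<longlonglongrightarrow> euler_mascheroni + gamma1 0 - gamma1 1 + 0"
    by (intro tendsto_add tendsto_diff LIMSEQ_Suc[OF A] A LIMSEQ_Suc[OF euler_mascheroni_LIMSEQ])
  then have "(\<lambda>n. \<Sum>k<Suc n. 1 / real (Suc k)
        + real k / real (Suc k) * (ln (real k) - ln (real (Suc k))))
      \<longlonglongrightarrow> euler_mascheroni + gamma1 0 - gamma1 1"
    unfolding sum_inner_pos A_def by (simp add: algebra_simps)
  from C_power_sums_eq[OF _ inner_sums_pos this] show ?thesis
    by simp
qed

lemma C_alternating_sums: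
  "(\<lambda>m. (-1) ^ (m + 2) * (C (m + 2) - euler_mascheroni))
    sums (ln (sqrt (2 * pi)) - euler_mascheroni / 2)"
proof -
  define f where "f n = ln (fact n) - real n * ln (real n) + real n - ln (real n) / 2" for n
  have f: "f \<longlonglongrightarrow> ln (2 * pi) / 2"
    unfolding f_def by (rule stirling_ln_fact)
  \<comment> \<open>The half logarithm in \<open>f (Suc n)\<close> cancels the one paired with
    \<open>harm\<close>, so this is exactly the sum in \<open>sum_inner_neg\<close>.\<close>
  have "(\<lambda>n. f (Suc n) - (harm (Suc n) - ln (real (Suc n))) / 2)
      \<longlonglongrightarrow> ln (2 * pi) / 2 - euler_mascheroni / 2"
    by (intro tendsto_intros LIMSEQ_Suc[OF f] LIMSEQ_Suc[OF euler_mascheroni_LIMSEQ]) auto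
  also have "(\<lambda>n. f (Suc n) - (harm (Suc n) - ln (real (Suc n))) / 2)
      = (\<lambda>n. \<Sum>k<Suc n. 1 - 1 / (2 * real (Suc k)) + real k * (ln (real k) - ln (real (Suc k))))"
    unfolding sum_inner_neg f_def
    by (simp add: algebra_simps diff_divide_distrib add_divide_distrib del: fact_Suc)
  also have "ln (2 * pi) / 2 = ln (sqrt (2 * pi))"
    by (simp add: ln_sqrt)
  finally show ?thesis
    using C_power_sums_eq[OF _ inner_sums_neg] by simp
qed

theorem proposition4p1:
  shows "(\<lambda>m. C m - euler_mascheroni) \<sim>[at_top] (\<lambda>m. zeta 2 / 2 ^ m) \<and>
    (\<lambda>m. C (m + 2) - euler_mascheroni) sums (euler_mascheroni + gamma1 0 - gamma1 1) \<and>
    (\<lambda>m. (-1) ^ (m + 2) * (C (m + 2) - euler_mascheroni))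
      sums (ln (sqrt (2 * pi)) - euler_mascheroni / 2)"
  using C_asymp C_sums C_alternating_sums by blast

end
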